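(* Let $r$ be a positive integer greater than $3$ and let $u\in N_{r,r}$. Then one of the following is true for some $p(x)\in\mathbb{Z}[x]$: (i) $r=4$, and either $u(x)=(x-1)+(x-1)(x-2)\cdots(x-r)\,p(x)$, or $u(x)=-2x^2+19x-39+p(x)(x-3)(x-4)(x-5)(x-6)$; (ii) $r\ge 5$, and $u(x)=(x-1)+(x-1)(x-2)\cdots(x-r)\,p(x)$.
   Context: $\mathbb{N}$ is the set of positive integers. For $u\in\mathbb{Z}[x]$ and $n\in\mathbb{N}$, $u^{(n)}$ denotes the $n$-fold composition $u\circ\cdots\circ u$. For $r\in\mathbb{Z}$, $u$ is called nilpotent at $r$ if there is $n\in\mathbb{N}$ with $u^{(n)}(r)=0$; the smallest such $n$ is called the index of $u$ at $r$. $N_{r,m}$ denotes the set of all $u\in\mathbb{Z}[x]$ that are nilpotent at $r$ of index $m$. *)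

theory Defs
  imports "HOL-Computational_Algebra.Polynomial"
begin

definition compose_pow :: "int poly \<Rightarrow> nat \<Rightarrow> int poly" where
  "compose_pow u n = (pcompose u ^^ n) [:0, 1:]"

definition nilpotent_at :: "int poly \<Rightarrow> int \<Rightarrow> bool" where
  "nilpotent_at u r \<longleftrightarrow> (\<exists>n>0. poly (compose_pow u n) r = 0)"

(* Meaningful only if u is nilpotent at r; the iteration count starts at 1. *)
definition nilpotency_index :: "int poly \<Rightarrow> int \<Rightarrow> nat" where
  "nilpotency_index u r = (LEAST n. n > 0 \<and> poly (compose_pow u n) r = 0)"

definition nilpotent_polys :: "int \<Rightarrow> nat \<Rightarrow> int poly set" where
  "nilpotent_polys r m = {u. nilpotent_at u r \<and> nilpotency_index u r = m}"

end

theory Submission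
  imports Defs
begin

text \<open>
  The orbit \<open>a 0 = r, a 1, \<dots>, a r = 0\<close> of \<open>r\<close> under \<open>u\<close> is injective, and \<open>a j - a i\<close> divides
  \<open>a (j + 1) - a (i + 1)\<close>. Such a sequence that starts with exactly \<open>k\<close> equal steps \<open>d\<close>
  continues with a step \<open>q * d\<close> where \<open>k\<close> and \<open>k - 1\<close> divide \<open>q - 1\<close>, so \<open>q\<close> is large compared with
  \<open>k\<close>. Splitting off the initial run of equal steps and inducting shows that the displacement
  \<open>a N - a 0\<close> exceeds \<open>N\<close> times the first step, unless the sequence is an arithmetic progression
  or one of a few exceptions with \<open>N \<le> 4\<close>. As the displacement here is \<open>- r\<close>, only the
  progression \<open>r, r - 1, \<dots>, 0\<close> and two exceptions with \<open>r = 4\<close> survive; \<open>4, 6, 8, 10, 0\<close> is not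
  interpolated by an integer polynomial, and \<open>4, 5, 6, 3, 0\<close> gives the second family.
\<close>

section \<open>Integer sequences with the divisibility property of polynomial orbits\<close>

text \<open>Only this much of a polynomial orbit enters the classification. No polynomial has to
  exist, so a sequence such as 4, 6, 8, 10, 0 qualifies and must be excluded separately.\<close>

definition orbit_like :: "(nat \<Rightarrow> int) \<Rightarrow> nat \<Rightarrow> bool" where
  "orbit_like a N \<longleftrightarrow> inj_on a {..N} \<and>
     (\<forall>i<N. \<forall>j<N. a j - a i dvd a (Suc j) - a (Suc i))"

text \<open>Here \<open>d\<close> stands for the first step \<open>a 1 - a 0\<close>.\<close>

definition sporadic :: "(nat \<Rightarrow> int) \<Rightarrow> nat \<Rightarrow> int \<Rightarrow> bool" where
  "sporadic a N d \<longleftrightarrow>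
     N = 2 \<and> (a 2 = a 0 - d \<or> a 2 = a 0 - 2 * d) \<or>
     N = 3 \<and> a 2 = a 0 - d \<and> (a 3 = a 0 + 3 * d \<or> a 3 = a 0 - 3 * d) \<or>
     N = 3 \<and> a 2 = a 0 + 2 * d \<and> (a 3 = a 0 - d \<or> a 3 = a 0 - 3 * d) \<or>
     N = 4 \<and> a 2 = a 0 + 2 * d \<and> a 3 = a 0 + 3 * d \<and> a 4 = a 0 - 2 * d \<or>
     N = 4 \<and> a 2 = a 0 + 2 * d \<and> a 3 = a 0 - d \<and> a 4 = a 0 - 4 * d"

lemma orbit_like_dvd:
  assumes "orbit_like a N" "i < N" "j < N"
  shows "a j - a i dvd a (Suc j) - a (Suc i)"
  using assms unfolding orbit_like_def by blast

lemma orbit_like_neq: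
  assumes "orbit_like a N" "i \<le> N" "j \<le> N" "i \<noteq> j"
  shows "a i \<noteq> a j"
  using assms unfolding orbit_like_def by (meson atMost_iff inj_onD)

lemma orbit_like_shift:
  assumes "orbit_like a (M + k)"
  shows "orbit_like (\<lambda>i. a (i + k)) M"
proof -
  have "inj_on (\<lambda>i. a (i + k)) {..M}"
  proof (rule inj_onI)
    fix x y assume "x \<in> {..M}" "y \<in> {..M}" "a (x + k) = a (y + k)"
    then show "x = y" using orbit_like_neq[OF assms, of "x + k" "y + k"] by auto
  qed
  then show ?thesis
    using orbit_like_dvd[OF assms, of "_ + k" "_ + k"] by (simp add: orbit_like_def)
qed

section \<open>Displacement of such sequences\<close>

text \<open>\<open>k - 1\<close> and \<open>k\<close> are coprime, so their product divides the
  nonzero number \<open>q - 1\<close> and \<open>\<bar>q\<bar>\<close> grows quadratically in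
  \<open>k\<close>. For \<open>k = 1\<close> the divisor \<open>k - 1\<close> is 0 and would force
  \<open>q = 1\<close>, hence the escape clause in the last hypothesis.\<close>

lemma run_ratio_cases:
  fixes q :: int and k :: nat
  assumes "q \<noteq> 0" "q \<noteq> 1" "q \<noteq> -1" "k \<ge> 1"
    and k: "int k dvd q - 1" and k': "int k - 1 dvd q - 1 \<or> k = 1"
  obtains "k = 1" "\<bar>q\<bar> \<ge> 2"
    | "k = 2" "odd q" "\<bar>q\<bar> \<ge> 3"
    | "k = 3" "q \<le> -11 \<or> q = -5 \<or> q \<ge> 7"
    | "k \<ge> 4" "\<bar>q\<bar> \<ge> 2 * int k + 3"
proof -
  consider "k = 1" | "k = 2" | "k = 3" | "k \<ge> 4" using assms(4) by linarith
  then show ?thesis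
  proof cases
    case 1 with assms that show ?thesis by linarith
  next
    case 2
    with k have "odd q" by (metis dvd_diff_right_iff odd_one of_nat_numeral)
    moreover from this have "\<bar>q\<bar> \<ge> 3" using assms(1-3) by presburger
    ultimately show ?thesis using 2 that by blast
  next
    case 3
    with k k' have "3 dvd q - 1" "2 dvd q - 1" by auto
    then have "q \<le> -11 \<or> q = -5 \<or> q \<ge> 7" using assms(2) by presburger
    with 3 that show ?thesis by blast
  next
    case 4
    have "coprime (int k - 1) (int k)"
      by (rule coprime_diff_one_left)
    with k k' 4 have "(int k - 1) * int k dvd q - 1"
      by (intro divides_mult) auto
    then have "\<bar>(int k - 1) * int k\<bar> \<le> \<bar>q - 1\<bar>"
      using assms(2) by (intro dvd_imp_le_int) auto
    \<comment> \<open>Rearranged, this reads \<open>(k - 1) * k \<ge> 2 * k + 4\<close>; passing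
      from \<open>q - 1\<close> to \<open>q\<close> costs 1.\<close>
    moreover have "(int k - 4) * (int k + 1) \<ge> 0" using 4 by simp
    moreover have "(int k - 1) * int k \<ge> 0" using 4 by simp
    ultimately have "\<bar>q\<bar> \<ge> 2 * int k + 3" by (simp add: algebra_simps)
    with 4 that show ?thesis by blast
  qed
qed

text \<open>A progression has displacement exactly \<open>N * \<bar>d\<bar>\<close>, so the first
  alternative asks for one step more. The induction applies to the tail after the initial run, whose
  first step \<open>q * d\<close> is so long that the run can hardly compensate for it.\<close>

lemma orbit_like_cases:
  assumes "orbit_like a N" "N \<ge> 1" "d = a 1 - a 0"
  shows "\<bar>a N - a 0\<bar> \<ge> (int N + 1) * \<bar>d\<bar> \<or> (\<forall>i\<le>N. a i = a 0 + int i * d) \<or> sporadic a N d"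
  using assms
proof (induction N arbitrary: a d rule: less_induct)
  case (less N)
  note dvd = orbit_like_dvd[OF less.prems(1)] and neq = orbit_like_neq[OF less.prems(1)]
  show ?case
  proof (cases "\<forall>i\<le>N. a i = a 0 + int i * d")
    case False
    \<comment> \<open>The progression first fails at \<open>j\<close>, so \<open>k = j - 1\<close>
      counts the equal steps of the initial run and \<open>m = k - 1\<close> starts its last
      step.\<close>
    define j where "j = (LEAST i. i \<le> N \<and> a i \<noteq> a 0 + int i * d)"
    have j: "j \<le> N" "a j \<noteq> a 0 + int j * d"
      using LeastI_ex[of "\<lambda>i. i \<le> N \<and> a i \<noteq> a 0 + int i * d"] False unfolding j_def by auto
    have lt_j: "a i = a 0 + int i * d" if "i < j" for i
      using not_less_Least[OF that[unfolded j_def]] that j(1) by auto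
    have "j \<noteq> 0" using j(2) by (intro notI) simp
    moreover have "j \<noteq> 1" using j(2) less.prems(3) by (intro notI) simp
    ultimately have "2 \<le> j" by linarith
    then obtain m where m: "j = Suc (Suc m)"
      by (auto simp: numeral_2_eq_2 Suc_le_eq gr0_conv_Suc dest!: less_imp_Suc_add)
    define k where "k = Suc m"
    have jk: "j = Suc k" by (simp add: m k_def)
    have run: "a i = a 0 + int i * d" if "i \<le> k" for i
      by (rule lt_j) (use that jk in simp)
    have ak: "a k = a 0 + int k * d" and am: "a m = a 0 + int m * d"
      by (rule run, simp add: k_def)+
    have ik: "int k = int m + 1" and mk: "m < k" by (simp_all add: k_def)
    define M where "M = N - k"
    have N: "N = M + k" and M: "M \<ge> 1" and k1: "k \<ge> 1"
      using j(1) by (auto simp: M_def jk k_def)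
    have d0: "d \<noteq> 0" using neq[of 0 1] less.prems by auto
    have "a k - a m dvd a (Suc k) - a (Suc m)" using dvd[of m k] N M k_def by simp
    moreover have "a k - a m = d" by (simp add: ak am ik algebra_simps)
    ultimately obtain q where "a (Suc k) - a k = d * q" by (auto simp: k_def dvd_def)
    then have q: "a (Suc k) = a k + q * d" by (simp add: algebra_simps)
    \<comment> \<open>The value 0 would repeat \<open>a k\<close>, the value 1 would prolong the
      run, and -1 would return to \<open>a m\<close>.\<close>
    have qne: "q \<noteq> 0" "q \<noteq> 1" "q \<noteq> -1"
    proof -
      show "q \<noteq> 0" using q neq[of k "Suc k"] N M by auto
      show "q \<noteq> 1" using j(2) by (auto simp: jk q ak algebra_simps)
      show "q \<noteq> -1" using neq[of m "Suc k"] N M mk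
        by (auto simp: q ak am ik algebra_simps)
    qed
    \<comment> \<open>Terms \<open>k\<close> and 0 are compared here, terms \<open>k\<close> and 1
      for the divisor \<open>k - 1\<close> below.\<close>
    have kq: "int k dvd q - 1"
    proof -
      have "a k - a 0 dvd a (Suc k) - a 1" using dvd[of 0 k] N M k1 by simp
      moreover have "a k - a 0 = int k * d" "a (Suc k) - a 1 = (int k + (q - 1)) * d"
        using less.prems(3) by (simp_all add: q ak algebra_simps)
      ultimately have "int k * d dvd (int k + (q - 1)) * d" by (simp only:)
      then show ?thesis using d0 by (simp add: dvd_add_right_iff)
    qed
    have k'q: "int k - 1 dvd q - 1 \<or> k = 1"
    proof (cases "k = 1")
      case False
      have "a k - a 1 dvd a (Suc k) - a 2" using dvd[of 1 k] N M k1 False by (simp add: numeral_2_eq_2)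
      moreover have "a 2 = a 0 + 2 * d" using run[of 2] k1 False by simp
      then have "a k - a 1 = (int k - 1) * d" "a (Suc k) - a 2 = ((int k - 1) + (q - 1)) * d"
        using less.prems(3) by (simp_all add: q ak algebra_simps)
      ultimately have "(int k - 1) * d dvd ((int k - 1) + (q - 1)) * d" by (simp only:)
      then show ?thesis using d0 by (metis dvd_mult_cancel_right dvd_add_right_iff dvd_refl)
    qed simp
    define b where "b = (\<lambda>i. a (i + k))"
    have b01: "b 0 = a 0 + int k * d" "b 1 = b 0 + q * d"
      using q ak by (auto simp: b_def)
    have IH: "\<bar>b M - b 0\<bar> \<ge> (int M + 1) * \<bar>q * d\<bar> \<or> (\<forall>i\<le>M. b i = b 0 + int i * (q * d))
        \<or> sporadic b M (q * d)"
    proof (rule less.IH)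
      show "M < N" using N k1 by simp
      show "orbit_like b M" using orbit_like_shift less.prems(1) N unfolding b_def by blast
    qed (use M b01 in auto)
    \<comment> \<open>Compares the displacements over two steps; \<open>q'\<close> is the ratio following \<open>q\<close>.\<close>
    have next_ratio: "1 + q dvd 1 + q'" if "M \<ge> 2" "b 2 = b 0 + (1 + q') * q * d" for q'
    proof -
      have "a (Suc k) - a m dvd a (Suc (Suc k)) - a (Suc m)"
        using dvd[of m "Suc k"] N that(1) k_def by simp
      moreover have "a (Suc (Suc k)) = b 2" by (simp add: b_def)
      then have "a (Suc k) - a m = (1 + q) * d" "a (Suc (Suc k)) - a (Suc m) = ((1 + q') * q) * d"
        using that(2) by (simp_all add: q ak am ik k_def[symmetric] b01 algebra_simps)
      ultimately have "(1 + q) * d dvd ((1 + q') * q) * d" by (simp only:)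
      then have "1 + q dvd (1 + q') * q" using d0 by simp
      moreover have "coprime (1 + q) q" by (metis coprime_add_one_left add.commute)
      ultimately show ?thesis by (simp add: coprime_dvd_mult_left_iff)
    qed
    have large: ?thesis if "a N = a 0 + w * d" "\<bar>w\<bar> \<ge> int N + 1" for w
      using that by (auto simp: abs_mult intro!: mult_right_mono)
    have aN: "a N = b M" by (simp add: b_def N)
    have qk: "\<bar>q\<bar> \<ge> int k + 1"
      using qne k1 kq k'q by (rule run_ratio_cases) auto
    \<comment> \<open>By the triangle inequality the whole displacement is at least
      \<open>W * \<bar>q * d\<bar> - k * \<bar>d\<bar>\<close>, and
      \<open>\<bar>q\<bar> \<ge> k + 1\<close>. Either condition on \<open>W\<close> then makes this
      reach \<open>(M + k + 1) * \<bar>d\<bar>\<close>.\<close>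
    have final: ?thesis if "\<bar>b M - b 0\<bar> \<ge> W * \<bar>q * d\<bar>" "W \<ge> 3 \<and> W \<ge> int M \<or> W \<ge> int M + 1" for W
    proof -
      have "(W * (int k + 1) - int k) * \<bar>d\<bar> = W * ((int k + 1) * \<bar>d\<bar>) - int k * \<bar>d\<bar>"
        by (simp add: algebra_simps)
      also have "\<dots> \<le> W * (\<bar>q\<bar> * \<bar>d\<bar>) - int k * \<bar>d\<bar>"
        using qk that(2) M by (intro diff_right_mono mult_left_mono mult_right_mono) auto
      also have "\<dots> \<le> \<bar>b M - b 0\<bar> - \<bar>int k * d\<bar>"
        using that(1) by (simp add: abs_mult)
      also have "\<dots> \<le> \<bar>a N - a 0\<bar>" using aN b01(1) by linarith
      finally have *: "(W * (int k + 1) - int k) * \<bar>d\<bar> \<le> \<bar>a N - a 0\<bar>" .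
      have W1: "W * (int k + 1) = W * int k + W" by (simp add: algebra_simps)
      have ints: "int N = int M + int k" "int k \<ge> 1" using N k1 by simp_all
      have "int N + 1 \<le> W * (int k + 1) - int k"
        using that(2)
      proof
        assume W: "W \<ge> 3 \<and> W \<ge> int M"
        then have "3 * int k \<le> W * int k" by (intro mult_right_mono) auto
        then show ?thesis using W W1 ints by linarith
      next
        assume W: "W \<ge> int M + 1"
        then have "2 * int k \<le> W * int k" using M by (intro mult_right_mono) auto
        then show ?thesis using W W1 ints by linarith
      qed
      then have "(int N + 1) * \<bar>d\<bar> \<le> (W * (int k + 1) - int k) * \<bar>d\<bar>"
        by (intro mult_right_mono) auto
      with * show ?thesis by linarith
    qed
    \<comment> \<open>The hypothesis arises from \<open>next_ratio\<close> when the tail has second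
      ratio \<open>q' = 1\<close> or \<open>q' = -3\<close>.\<close>
    have small_q: "q = -2 \<and> k = 1 \<or> q = -3 \<and> k = 1 \<or> q = -3 \<and> k = 2" if "1 + q dvd 2"
    proof -
      have "\<bar>1 + q\<bar> \<le> 2" using that by (metis abs_numeral dvd_imp_le_int zero_neq_numeral)
      then have "q = -2 \<or> q = -3" using qne by linarith
      then show ?thesis using qne k1 kq k'q by (elim run_ratio_cases) auto
    qed
    from IH consider (large) "\<bar>b M - b 0\<bar> \<ge> (int M + 1) * \<bar>q * d\<bar>"
      | (ap) "\<forall>i\<le>M. b i = b 0 + int i * (q * d)" | (sp) "sporadic b M (q * d)" by blast
    then show ?thesis
    proof cases
      case large
      then show ?thesis by (rule final) simp
    next
      case ap
      then have bM: "b M = b 0 + int M * (q * d)" by blast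
      then have w: "a N = a 0 + (int k + int M * q) * d"
        using aN b01 by (simp add: algebra_simps)
      \<comment> \<open>For \<open>M \<le> 2\<close> a tail displacement of
        \<open>M * \<bar>q * d\<bar>\<close> is too small for \<open>final\<close>. The factor
        \<open>k + M * q\<close> is then inspected directly; its few small values give sporadic
        patterns.\<close>
      consider "M = 1" | "M = 2" | "M \<ge> 3" using M by linarith
      then show ?thesis
      proof cases
        case 1
        from qne k1 kq k'q show ?thesis
        proof (rule run_ratio_cases)
          assume "k = 1" "\<bar>q\<bar> \<ge> 2"
          moreover from this have "q = -2 \<or> q = -3 \<or> \<bar>1 + q\<bar> \<ge> 3" by linarith
          moreover have "N = 2" using \<open>k = 1\<close> 1 N by simp
          moreover note w
          ultimately have "sporadic a N d \<or> \<bar>int k + int M * q\<bar> \<ge> int N + 1"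
            using 1 unfolding sporadic_def by auto
          with large[OF w] show ?thesis by blast
        next
          assume k: "k = 2" and "odd q" "\<bar>q\<bar> \<ge> 3"
          then have "q = -3 \<or> q = -5 \<or> \<bar>2 + q\<bar> \<ge> 4" by presburger
          moreover have "N = 3" using k 1 N by simp
          moreover note w run[of 2]
          ultimately have "sporadic a N d \<or> \<bar>int k + int M * q\<bar> \<ge> int N + 1"
            using k 1 unfolding sporadic_def by auto
          with large[OF w] show ?thesis by blast
        next
          assume k: "k = 3" and "q \<le> -11 \<or> q = -5 \<or> q \<ge> 7"
          then have "q = -5 \<or> \<bar>3 + q\<bar> \<ge> 5" by linarith
          moreover have "N = 4" using k 1 N by simp
          moreover note w run[of 2] run[of 3]
          ultimately have "sporadic a N d \<or> \<bar>int k + int M * q\<bar> \<ge> int N + 1"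
            using k 1 unfolding sporadic_def by auto
          with large[OF w] show ?thesis by blast
        next
          assume "k \<ge> 4" "\<bar>q\<bar> \<ge> 2 * int k + 3"
          then have "\<bar>int k + q\<bar> \<ge> int k + 2" by linarith
          then show ?thesis using large[OF w] 1 N by simp
        qed
      next
        case 2
        from qne k1 kq k'q show ?thesis
        proof (rule run_ratio_cases)
          assume k: "k = 1" and "\<bar>q\<bar> \<ge> 2"
          then have "q = -2 \<or> \<bar>1 + 2 * q\<bar> \<ge> 4" by linarith
          moreover have "N = 3" using k 2 N by simp
          moreover note w
          moreover have "a 2 = a 0 + (1 + q) * d" using q ak k by (simp add: numeral_2_eq_2 algebra_simps)
          ultimately have "sporadic a N d \<or> \<bar>int k + int M * q\<bar> \<ge> int N + 1"
            using k 2 unfolding sporadic_def by auto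
          with large[OF w] show ?thesis by blast
        next
          assume k: "k = 2" and "odd q" "\<bar>q\<bar> \<ge> 3"
          then have "q = -3 \<or> \<bar>2 + 2 * q\<bar> \<ge> 5" by presburger
          moreover have "N = 4" using k 2 N by simp
          moreover note w run[of 2]
          moreover have "a 3 = a 0 + (2 + q) * d" using q ak k by (simp add: eval_nat_numeral algebra_simps)
          ultimately have "sporadic a N d \<or> \<bar>int k + int M * q\<bar> \<ge> int N + 1"
            using k 2 unfolding sporadic_def by auto
          with large[OF w] show ?thesis by blast
        next
          assume k: "k = 3" and "q \<le> -11 \<or> q = -5 \<or> q \<ge> 7"
          then have "\<bar>3 + 2 * q\<bar> \<ge> 6" by linarith
          then show ?thesis using large[OF w] k 2 N by simp
        next
          assume "k \<ge> 4" "\<bar>q\<bar> \<ge> 2 * int k + 3"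
          then have "\<bar>int k + 2 * q\<bar> \<ge> int k + 3" by linarith
          then show ?thesis using large[OF w] 2 N by simp
        qed
      next
        case 3
        then show ?thesis using bM by (intro final[of "int M"]) (auto simp: abs_mult)
      qed
    next
      case sp
      consider "M = 2" "b 2 = b 0 - q * d" | "M = 2" "b 2 = b 0 - 2 * (q * d)"
        | "M = 3" "\<bar>b 3 - b 0\<bar> = 3 * \<bar>q * d\<bar>"
        | "M = 3" "b 2 = b 0 + 2 * (q * d)" "b 3 = b 0 - q * d"
        | "M = 4" "b 2 = b 0 + 2 * (q * d)" "b 3 = b 0 + 3 * (q * d)" "b 4 = b 0 - 2 * (q * d)"
        | "M = 4" "\<bar>b 4 - b 0\<bar> = 4 * \<bar>q * d\<bar>"
        using sp unfolding sporadic_def by (auto simp: abs_mult)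
      then show ?thesis
      proof cases
        \<comment> \<open>This is the only sporadic tail that yields a sporadic sequence:
          \<open>a 2 = a 0 - d\<close>, \<open>a 3 = a 0 + 3 * d\<close>.\<close>
        case 1
        then have "1 + q dvd 1 + (-2)" by (intro next_ratio) auto
        then have "q = -2" using qne by (auto simp: zdvd1_eq)
        moreover from this small_q have "k = 1" by auto
        moreover from this have "N = 3" using 1 N by simp
        moreover from calculation have "a 2 = a 0 - d" using q ak by (simp add: numeral_2_eq_2)
        moreover from calculation have "a 3 = a 0 + 3 * d" using 1 aN b01 by simp
        ultimately show ?thesis by (simp add: sporadic_def)
      next
        case 2
        then have "1 + q dvd 1 + (-3)" by (intro next_ratio) auto
        then have "1 + q dvd 2" by simp
        moreover have w: "a N = a 0 + (int k - 2 * q) * d"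
          using aN b01 2 by (simp add: algebra_simps)
        ultimately show ?thesis using small_q large[OF w] 2 N by auto
      next
        case 3
        then show ?thesis by (intro final[of 3]) auto
      next
        \<comment> \<open>The tail displacement is only \<open>\<bar>q * d\<bar>\<close>, so size
          does not help. Each surviving \<open>q\<close> is refuted by comparing the term before the
          last of the run, \<open>a (k - 1)\<close>, with \<open>b 2\<close>.\<close>
        case 4
        then have "1 + q dvd 1 + 1" by (intro next_ratio) auto
        with small_q consider "q = -2" "k = 1" | "q = -3" "k = 1" | "q = -3" "k = 2" by auto
        then have False
        proof cases
          case 1
          have "a 3 - a 0 dvd a 4 - a 1" using dvd[of 0 3] N 1 4 by (simp add: eval_nat_numeral)
          moreover have "a 3 = b 2" "a 4 = b 3" using 1 by (simp_all add: b_def eval_nat_numeral)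
          then have "a 3 - a 0 = (-3) * d" "a 4 - a 1 = 2 * d"
            using run[of 1] 1 4 b01 by simp_all
          ultimately have "(-3) * d dvd 2 * d" by (simp only:)
          then show False using d0 by simp
        next
          case 2
          have "a 3 - a 0 dvd a 4 - a 1" using dvd[of 0 3] N 2 4 by (simp add: eval_nat_numeral)
          moreover have "a 3 = b 2" "a 4 = b 3" using 2 by (simp_all add: b_def eval_nat_numeral)
          then have "a 3 - a 0 = (-5) * d" "a 4 - a 1 = 3 * d"
            using run[of 1] 2 4 b01 by simp_all
          ultimately have "(-5) * d dvd 3 * d" by (simp only:)
          then show False using d0 by simp
        next
          case 3
          have "a 4 - a 1 dvd a 5 - a 2" using dvd[of 1 4] N 3 4 by (simp add: eval_nat_numeral)
          moreover have "a 4 = b 2" "a 5 = b 3" using 3 by (simp_all add: b_def eval_nat_numeral)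
          then have "a 4 - a 1 = (-5) * d" "a 5 - a 2 = 3 * d"
            using run[of 1] run[of 2] 3 4 b01 by simp_all
          ultimately have "(-5) * d dvd 3 * d" by (simp only:)
          then show False using d0 by simp
        qed
        then show ?thesis ..
      next
        \<comment> \<open>For \<open>q = -3\<close> the factor \<open>k + 6\<close> reaches
          \<open>N + 1 = k + 5\<close>. For \<open>q = -2\<close>, \<open>k = 1\<close> it is 5 and
          misses 6, so a divisibility contradiction is needed.\<close>
        case 5
        then have "1 + q dvd 1 + 1" by (intro next_ratio) auto
        with small_q consider "q = -2" "k = 1" | "q = -3" by auto
        then show ?thesis
        proof cases
          case 1
          have "a 4 - a 0 dvd a 5 - a 1" using dvd[of 0 4] N 1 5 by (simp add: eval_nat_numeral)
          moreover have "a 4 = b 3" "a 5 = b 4" using 1 by (simp_all add: b_def eval_nat_numeral)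
          then have "a 4 - a 0 = (-5) * d" "a 5 - a 1 = 4 * d"
            using run[of 1] 1 5 b01 by simp_all
          ultimately have "(-5) * d dvd 4 * d" by (simp only:)
          then have False using d0 by simp
          then show ?thesis ..
        next
          case 2
          have w: "a N = a 0 + (int k - 2 * q) * d"
            using aN b01 5 by (simp add: algebra_simps)
          show ?thesis using large[OF w] 2 5 N by auto
        qed
      next
        case 6
        then show ?thesis by (intro final[of 4]) auto
      qed
    qed
  qed blast
qed

section \<open>Divisibility facts for polynomials\<close>

text \<open>Roots are split off one at a time: the product over the earlier roots does not vanish at
  the new root \<open>c\<close>, so in a domain the cofactor must.\<close>

lemma prod_linear_factors_dvd:
  fixes p :: "'a :: idom poly"
  assumes "finite A" "\<And>c. c \<in> A \<Longrightarrow> poly p c = 0"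
  shows "(\<Prod>c\<in>A. [:- c, 1:]) dvd p"
  using assms
proof (induction A)
  case (insert c A)
  then obtain s where s: "p = (\<Prod>c\<in>A. [:- c, 1:]) * s" by (auto simp: dvd_def)
  have "poly (\<Prod>c\<in>A. [:- c, 1:]) c \<noteq> 0" using insert.hyps by (auto simp: poly_prod)
  moreover have "poly p c = 0" using insert.prems by simp
  ultimately have "poly s c = 0" by (simp add: s)
  then have "[:- c, 1:] dvd s" by (simp add: poly_eq_0_iff_dvd)
  then have "[:- c, 1:] * (\<Prod>c\<in>A. [:- c, 1:]) dvd s * (\<Prod>c\<in>A. [:- c, 1:])"
    by (rule mult_dvd_mono) simp
  then show ?case using insert.hyps by (simp only: prod.insert[OF insert.hyps(1,2)] s mult.commute)
qed simp

lemma poly_compose_pow: "poly (compose_pow u n) x = (poly u ^^ n) x"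
  unfolding compose_pow_def by (induction n) (auto simp: poly_pcompose)

text \<open>The factor theorem for \<open>u\<close> minus the constant \<open>poly u y\<close>; it
  supplies the divisibility in \<open>orbit_like\<close>.\<close>

lemma poly_diff_dvd:
  fixes u :: "'a :: comm_ring_1 poly"
  shows "x - y dvd poly u x - poly u y"
proof -
  have "[:-y, 1:] dvd u - [:poly u y:]" by (simp add: poly_eq_0_iff_dvd[symmetric])
  then obtain s where "u - [:poly u y:] = [:-y, 1:] * s" by (auto simp: dvd_def)
  then have "poly (u - [:poly u y:]) x = poly ([:-y, 1:] * s) x" by simp
  then have "poly u x - poly u y = (x - y) * poly s x" by (simp add: algebra_simps)
  then show ?thesis by simp
qed

section \<open>Polynomials nilpotent at \<open>r\<close> of index \<open>r\<close>\<close>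

theorem theorem4p3:
  fixes r :: nat and u :: "int poly"
  assumes "r > 3"
    and "u \<in> nilpotent_polys (int r) r"
  shows "\<exists>p :: int poly.
      (r = 4 \<and>
        (u = [:-1, 1:] + (\<Prod>k = 1..r. [:- int k, 1:]) * p \<or>
         u = [:-39, 19, -2:] + p * ([:-3, 1:] * [:-4, 1:] * [:-5, 1:] * [:-6, 1:]))) \<or>
      (r \<ge> 5 \<and> u = [:-1, 1:] + (\<Prod>k = 1..r. [:- int k, 1:]) * p)"
proof -
  define a where "a i = (poly u ^^ i) (int r)" for i
  define d where "d = a 1 - a 0"
  have a0: "a 0 = int r" and aSuc: "poly u (a i) = a (Suc i)" for i by (auto simp: a_def)
  have nil: "nilpotent_at u (int r)" and idx: "nilpotency_index u (int r) = r"
    using assms(2) by (auto simp: nilpotent_polys_def)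
  have ar: "a r = 0"
    using LeastI_ex[OF nil[unfolded nilpotent_at_def]] idx
    by (simp add: nilpotency_index_def a_def poly_compose_pow)
  have nz: "a i \<noteq> 0" if "i < r" for i
  \<comment> \<open>Minimality of the index concerns positive iteration counts only; at 0 the value
    is \<open>r\<close> itself.\<close>
  proof (cases "i = 0")
    case False
    with that show ?thesis
      using not_less_Least[of i "\<lambda>n. n > 0 \<and> poly (compose_pow u n) (int r) = 0"] idx
      by (simp add: nilpotency_index_def a_def poly_compose_pow)
  qed (use assms in \<open>simp add: a0\<close>)
  have "a i \<noteq> a j" if "i < j" "j \<le> r" for i j
  proof
    assume eq: "a i = a j"
    \<comment> \<open>A repetition would let the orbit skip \<open>j - i\<close> steps and reach 0
      before time \<open>r\<close>.\<close>
    have "a (i + n) = a (j + n)" for n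
      by (induction n) (auto simp: eq aSuc[symmetric])
    from this[of "r - j"] have "a (i + (r - j)) = 0" using that ar by simp
    moreover have "i + (r - j) < r" using that by simp
    ultimately show False using nz by blast
  qed
  then have "inj_on a {..r}" by (intro linorder_inj_onI) auto
  then have "orbit_like a r"
    by (auto simp: orbit_like_def aSuc[symmetric] poly_diff_dvd)
  then have cases: "\<bar>a r - a 0\<bar> \<ge> (int r + 1) * \<bar>d\<bar> \<or> (\<forall>i\<le>r. a i = a 0 + int i * d)
      \<or> sporadic a r d"
    by (intro orbit_like_cases) (use assms d_def in auto)
  have "d \<noteq> 0" using \<open>inj_on a {..r}\<close> assms(1) by (auto simp: d_def inj_on_def)
  then have "(int r + 1) * 1 \<le> (int r + 1) * \<bar>d\<bar>" by (intro mult_left_mono) auto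
  then have "int r < (int r + 1) * \<bar>d\<bar>" by (simp only: mult_1_right add1_zle_eq)
  moreover have "\<bar>a r - a 0\<bar> = int r" using ar a0 by simp
  ultimately have "\<not> \<bar>a r - a 0\<bar> \<ge> (int r + 1) * \<bar>d\<bar>" by (simp only: not_le)
  with cases consider (ap) "\<forall>i\<le>r. a i = a 0 + int i * d" | (sp) "sporadic a r d" by blast
  then show ?thesis
  proof cases
    case ap
    then have "int r * (d + 1) = 0" using ar a0 by (simp add: algebra_simps)
    then have "d = -1" using assms(1) by simp
    \<comment> \<open>The orbit is \<open>r, r - 1, \<dots>, 0\<close>, so \<open>k\<close> is
      visited at time \<open>r - k\<close>.\<close>
    have "poly u (int k) = int k - 1" if "k \<in> {1..r}" for k
    proof -
      have "a (r - k) = int k" "a (Suc (r - k)) = int k - 1"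
        using ap \<open>d = -1\<close> that by (auto simp: a0 of_nat_diff)
      then show ?thesis using aSuc[of "r - k"] by simp
    qed
    then have "(\<Prod>c\<in>int ` {1..r}. [:- c, 1:]) dvd u - [:-1, 1:]"
      by (intro prod_linear_factors_dvd) auto
    then have "(\<Prod>k = 1..r. [:- int k, 1:]) dvd u - [:-1, 1:]"
      by (simp add: prod.reindex)
    then obtain p where "u - [:-1, 1:] = (\<Prod>k = 1..r. [:- int k, 1:]) * p" by (auto simp: dvd_def)
    then have "u = [:-1, 1:] + (\<Prod>k = 1..r. [:- int k, 1:]) * p" by (metis add.commute diff_add_cancel)
    then show ?thesis using assms(1) by (intro exI[of _ p]) linarith
  next
    case sp
    have a1: "a 1 = a 0 + d" by (simp add: d_def)
    have u: "poly u (a 0) = a 1" "poly u (a 1) = a 2" "poly u (a 2) = a 3" "poly u (a 3) = a 4"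
      by (simp_all add: aSuc eval_nat_numeral)
    from sp assms(1) have r: "r = 4"
      and "a 2 = a 0 + 2 * d \<and> a 3 = a 0 + 3 * d \<and> a 4 = a 0 - 2 * d \<or>
           a 2 = a 0 + 2 * d \<and> a 3 = a 0 - d \<and> a 4 = a 0 - 4 * d"
      by (auto simp: sporadic_def)
    then show ?thesis
    proof (elim disjE conjE)
      assume *: "a 2 = a 0 + 2 * d" "a 3 = a 0 + 3 * d" "a 4 = a 0 - 2 * d"
      with ar a0 r have "d = 2" by simp
      with * a1 a0 r u ar have v: "poly u 4 = 6" "poly u 6 = 8" "poly u 8 = 10" "poly u 10 = 0" by auto
      \<comment> \<open>\<open>u\<close> agrees with \<open>x + 2\<close> at 4, 6, 8, so
        \<open>u(10) - 12 = -12\<close> would have to be a multiple of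
        \<open>6 * 4 * 2 = 48\<close>.\<close>
      have "(\<Prod>c\<in>{4, 6, 8}. [:- c, 1:]) dvd u - [:2, 1:]"
        by (intro prod_linear_factors_dvd) (auto simp: v)
      then obtain s where "u - [:2, 1:] = (\<Prod>c\<in>{4, 6, 8}. [:- c, 1:]) * s" by (auto simp: dvd_def)
      then have "poly (u - [:2, 1:]) 10 = poly ((\<Prod>c\<in>{4, 6, 8}. [:- c, 1:]) * s) 10" by simp
      then have "-12 = 48 * poly s 10" using v by (simp add: poly_prod)
      then have False by presburger
      then show ?thesis ..
    next
      assume *: "a 2 = a 0 + 2 * d" "a 3 = a 0 - d" "a 4 = a 0 - 4 * d"
      with ar a0 r have "d = 1" by simp
      with * a1 a0 r u ar have v: "poly u 4 = 5" "poly u 5 = 6" "poly u 6 = 3" "poly u 3 = 0" by auto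
      \<comment> \<open>The quadratic interpolates the orbit 4, 5, 6, 3, 0.\<close>
      have "(\<Prod>c\<in>{3, 4, 5, 6}. [:- c, 1:]) dvd u - [:-39, 19, -2:]"
        by (intro prod_linear_factors_dvd) (auto simp: v)
      then obtain p where "u - [:-39, 19, -2:] = (\<Prod>c\<in>{3, 4, 5, 6}. [:- c, 1:]) * p" by (auto simp: dvd_def)
      also have "(\<Prod>c\<in>{3, 4, 5, 6}. [:- c, 1:]) = [:-3, 1:] * [:-4, 1:] * [:-5, 1:] * [:-6, 1 :: int:]"
        by (simp add: mult.assoc)
      finally have "u = [:-39, 19, -2:] + p * ([:-3, 1:] * [:-4, 1:] * [:-5, 1:] * [:-6, 1:])"
        by (metis add.commute diff_add_cancel mult.commute)
      then show ?thesis using r by blast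
    qed
  qed
qed

end
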